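(* Let $n$ be an odd positive integer and let $k, r$ be positive integers. There exists an absolutely flat idempotent with parameters $n,k,r$ if and only if $r=1$, $k\le n$ and $k$ is odd. In this event, the absolutely flat idempotent $A$ with parameters $n,k,r$ is unique up to signature/permutation similarity: every such matrix is signature/permutation similar to $$A=\frac{1}{k}\begin{bmatrix} 1 & \cdots & 1 & -1 & \cdots & -1 \\ \vdots & \ddots & \vdots & \vdots & \ddots & \vdots \\ 1 & \cdots & 1 & -1 & \cdots & -1 \end{bmatrix},$$ the $n\times n$ matrix all of whose rows are equal, in which the first $n-m$ columns are columns of $1$'s and the last $m=(n-rk)/2=(n-k)/2$ columns are columns of $-1$'s (before multiplication by $1/k$).
   Context: For positive integers $n,k,r$, an absolutely flat idempotent with parameters $n,k,r$ is a real $n\times n$ matrix $A$ with $A^2=A$, rank $r$, and every entry equal to $1/k$ or $-1/k$. A signature matrix is a diagonal matrix with all diagonal entries in $\{1,-1\}$. Two $n\times n$ matrices are signature/permutation similar if one is obtained from the other by a finite sequence of similarities $X\mapsto T^{-1}XT$ in which each $T$ is a signature matrix or a permutation matrix. *)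

theory Defs
  imports
    "Jordan_Normal_Form.DL_Rank"
    "HOL-Combinatorics.Permutations"
begin

definition absolutely_flat_idempotent :: "nat \<Rightarrow> nat \<Rightarrow> nat \<Rightarrow> real mat \<Rightarrow> bool" where
  "absolutely_flat_idempotent n k r A \<longleftrightarrow>
     A \<in> carrier_mat n n \<and> A * A = A \<and> vec_space.rank n A = r \<and>
     (\<forall>i<n. \<forall>j<n. A $$ (i, j) = 1 / real k \<or> A $$ (i, j) = - (1 / real k))"

definition signature_mat :: "nat \<Rightarrow> real mat \<Rightarrow> bool" where
  "signature_mat n T \<longleftrightarrow>
     T \<in> carrier_mat n n \<and> diagonal_mat T \<and> (\<forall>i<n. T $$ (i, i) \<in> {1, -1})"

definition permutation_mat :: "nat \<Rightarrow> real mat \<Rightarrow> bool" where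
  "permutation_mat n T \<longleftrightarrow>
     (\<exists>p. p permutes {..<n} \<and> T = mat n n (\<lambda>(i, j). if i = p j then 1 else 0))"

(* similar_mat_wit Y X T' T says that X and Y are square of the same size,
   T' is the inverse of T, and Y = T' * X * T. *)
definition sp_similarity_step :: "nat \<Rightarrow> real mat \<Rightarrow> real mat \<Rightarrow> bool" where
  "sp_similarity_step n X Y \<longleftrightarrow>
     (\<exists>T T'. (signature_mat n T \<or> permutation_mat n T) \<and> similar_mat_wit Y X T' T)"

definition sp_similar :: "nat \<Rightarrow> real mat \<Rightarrow> real mat \<Rightarrow> bool" where
  "sp_similar n = (sp_similarity_step n)\<^sup>*\<^sup>*"

definition equal_rows_flat_mat :: "nat \<Rightarrow> nat \<Rightarrow> nat \<Rightarrow> real mat" where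
  "equal_rows_flat_mat n k m =
     (1 / real k) \<cdot>\<^sub>m mat n n (\<lambda>(i, j). if j < n - m then 1 else -1)"

end

theory Submission
  imports Defs "HOL-Number_Theory.Cong"
begin

text \<open>
  Write an absolutely flat idempotent as \<open>A = B / k\<close> with \<open>B\<close> a sign matrix; idempotency becomes
  \<open>B\<^sup>2 = k B\<close>.  The proof rests on a congruence: a sum of \<open>n\<close> signs is congruent to \<open>n - 1\<close> plus
  their product modulo 4.  Applied to the \<open>(i, j)\<close> entry of \<open>B\<^sup>2\<close>, whose \<open>n\<close> summands are the
  signs \<open>B\<^sub>i\<^sub>l B\<^sub>l\<^sub>j\<close>, it gives
  \<open>k B\<^sub>i\<^sub>j \<equiv> n - 1 + R\<^sub>i C\<^sub>j (mod 4)\<close>, where \<open>R\<^sub>i\<close> is the product of row \<open>i\<close> and \<open>C\<^sub>j\<close> the product of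
  column \<open>j\<close>.  For odd \<open>n\<close> the right-hand side is congruent to \<open>n R\<^sub>i C\<^sub>j\<close>, so \<open>B\<^sub>i\<^sub>j = s R\<^sub>i C\<^sub>j\<close> for a
  sign \<open>s\<close> that depends only on \<open>n\<close> and \<open>k\<close> (\<open>sign_matrix_square_factors\<close>).

  Hence \<open>B = u w\<^sup>T\<close> for sign vectors \<open>u, w\<close>, so the rank is 1, and \<open>B\<^sup>2 = k B\<close> reduces to
  \<open>\<Sum> u\<^sub>l w\<^sub>l = k\<close>.  A sum of \<open>n\<close> signs can be \<open>k\<close> only if \<open>k \<le> n\<close> and \<open>k\<close> has the parity of \<open>n\<close>.
  Conjugating \<open>A\<close> by the signature matrix of \<open>u\<close> makes all rows equal to \<open>v / k\<close>, where
  \<open>v\<^sub>j = u\<^sub>j w\<^sub>j\<close>.  Two sign vectors of equal length and equal sum differ by a permutation, so a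
  permutation similarity sorts \<open>v\<close> into the pattern of the normal form.
\<close>

section \<open>Sums of signs\<close>

lemma sign_mult: "a * b \<in> {1, -1}" if "a \<in> {1, -1}" and "b \<in> {1, -1}" for a b :: int
  using that by auto

text \<open>
  Turning one summand from 1 into -1 changes the sum by 2 and negates the product, which also
  changes it by 2; modulo 4 the direction of the change does not matter.
\<close>

lemma sum_signs_cong_prod:
  fixes f :: "'a \<Rightarrow> int"
  assumes "finite S" and "\<forall>x\<in>S. f x \<in> {1, -1}"
  shows "[sum f S = int (card S) - 1 + prod f S] (mod 4) \<and> prod f S \<in> {1, -1}"
  using assms
proof (induction S rule: finite_induct)
  case empty
  then show ?case by simp
next
  case (insert x S)
  then have IH: "[sum f S = int (card S) - 1 + prod f S] (mod 4)"
    and P: "prod f S = 1 \<or> prod f S = -1" and fx: "f x = 1 \<or> f x = -1"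
    by auto
  have "[f x + sum f S = f x + (int (card S) - 1 + prod f S)] (mod 4)"
    using IH by (intro cong_add) simp_all
  also have "[f x + (int (card S) - 1 + prod f S) = int (card S) + f x * prod f S] (mod 4)"
    using fx P by (auto simp: cong_iff_dvd_diff)
  finally have "[f x + sum f S = int (card S) + f x * prod f S] (mod 4)" .
  moreover have "f x * prod f S = 1 \<or> f x * prod f S = -1"
    using fx P by auto
  ultimately show ?case
    using insert.hyps by simp
qed

lemma sum_signs_eq_card:
  fixes f :: "'a \<Rightarrow> int"
  assumes "finite S" and "\<forall>x\<in>S. f x \<in> {1, -1}"
  shows "sum f S = 2 * int (card {x \<in> S. f x = 1}) - int (card S)"
proof -
  have "sum f S = (\<Sum>x\<in>S. 2 * of_bool (f x = 1) - 1)"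
    using assms(2) by (intro sum.cong) auto
  also have "\<dots> = 2 * int (card {x \<in> S. f x = 1}) - int (card S)"
    using assms(1) by (simp add: sum_subtractf sum_distrib_left[symmetric] Int_def)
  finally show ?thesis .
qed

lemma signs_permuted_of_sum_eq:
  fixes f g :: "'a \<Rightarrow> int"
  assumes S: "finite S" and f: "\<forall>x\<in>S. f x \<in> {1, -1}" and g: "\<forall>x\<in>S. g x \<in> {1, -1}"
    and eq: "sum f S = sum g S"
  obtains p where "p permutes S" and "\<forall>x\<in>S. f x = g (p x)"
proof -
  have mset: "image_mset h (mset_set S) =
      replicate_mset (card {x \<in> S. h x = 1}) 1 +
      replicate_mset (card S - card {x \<in> S. h x = 1}) (-1)"
    if h: "\<forall>x\<in>S. h x \<in> {1, -1}" for h :: "'a \<Rightarrow> int"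
  proof -
    let ?P = "{x \<in> S. h x = 1}"
    have "mset_set S = mset_set ?P + mset_set (S - ?P)"
      using S by (subst mset_set_Union[symmetric]) (auto intro!: arg_cong[where f = mset_set])
    then have "image_mset h (mset_set S) =
        image_mset h (mset_set ?P) + image_mset h (mset_set (S - ?P))"
      by simp
    also have "image_mset h (mset_set ?P) = image_mset (\<lambda>_. 1) (mset_set ?P)"
      using S by (intro image_mset_cong) simp
    also have "image_mset h (mset_set (S - ?P)) = image_mset (\<lambda>_. -1) (mset_set (S - ?P))"
      using S h by (intro image_mset_cong) auto
    also have "card (S - ?P) = card S - card ?P"
      using S by (intro card_Diff_subset) auto
    ultimately show ?thesis
      by (simp add: image_mset_const_eq)
  qed
  have "card {x \<in> S. f x = 1} = card {x \<in> S. g x = 1}"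
    using eq sum_signs_eq_card[OF S f] sum_signs_eq_card[OF S g] by simp
  then have "image_mset f (mset_set S) = image_mset g (mset_set S)"
    by (simp add: mset[OF f] mset[OF g])
  from image_mset_eq_implies_permutes[OF S this] that show thesis by blast
qed

section \<open>Sign matrices with square a multiple of themselves\<close>

text \<open>
  For odd \<open>n\<close> and a sign \<open>e\<close>, the number \<open>n - 1 + e\<close> is congruent to \<open>n e\<close> modulo 4, so the
  congruence for the entries of \<open>B\<^sup>2\<close> reads \<open>k B\<^sub>i\<^sub>j \<equiv> n R\<^sub>i C\<^sub>j\<close>.  As \<open>n\<close> and \<open>-n\<close> differ modulo 4,
  comparing \<open>k\<close> with \<open>n\<close> decides the sign of \<open>B\<^sub>i\<^sub>j\<close> against \<open>R\<^sub>i C\<^sub>j\<close>, uniformly in \<open>i\<close> and \<open>j\<close>.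
  Both factors being signs, the identity \<open>B\<^sup>2 = k B\<close> can then be divided by any single entry to give the last conclusion.
\<close>

lemma sign_matrix_square_factors:
  fixes b :: "nat \<Rightarrow> nat \<Rightarrow> int" and k :: int
  assumes n: "odd n"
    and b: "\<And>i j. i < n \<Longrightarrow> j < n \<Longrightarrow> b i j \<in> {1, -1}"
    and sq: "\<And>i j. i < n \<Longrightarrow> j < n \<Longrightarrow> (\<Sum>l<n. b i l * b l j) = k * b i j"
  obtains u w :: "nat \<Rightarrow> int"
  where "\<forall>i<n. u i \<in> {1, -1}" and "\<forall>i<n. w i \<in> {1, -1}"
    and "\<forall>i<n. \<forall>j<n. b i j = u i * w j"
    and "(\<Sum>l<n. u l * w l) = k"
proof -
  define R where "R i = (\<Prod>l<n. b i l)" for i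
  define C where "C j = (\<Prod>l<n. b l j)" for j
  define s :: int where "s = (if [k = int n] (mod 4) then 1 else -1)"
  define w where "w j = s * C j" for j
  have R: "R i = 1 \<or> R i = -1" if "i < n" for i
    using sum_signs_cong_prod[of "{..<n}" "b i"] b that by (auto simp: R_def)
  have C: "C j = 1 \<or> C j = -1" if "j < n" for j
    using sum_signs_cong_prod[of "{..<n}" "\<lambda>l. b l j"] b that by (auto simp: C_def)
  have s: "s = 1 \<or> s = -1" by (simp add: s_def)
  have fact: "b i j = R i * w j" if ij: "i < n" "j < n" for i j
  proof -
    have "b i l * b l j \<in> {1, -1}" if "l < n" for l
      using sign_mult[OF b[OF ij(1) that] b[OF that ij(2)]] .
    then have "[(\<Sum>l<n. b i l * b l j) = int n - 1 + (\<Prod>l<n. b i l * b l j)] (mod 4)"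
      using sum_signs_cong_prod[of "{..<n}" "\<lambda>l. b i l * b l j"] by simp
    then have "[k * b i j = int n - 1 + R i * C j] (mod 4)"
      using sq[OF ij] by (simp add: prod.distrib R_def C_def)
    also have "[int n - 1 + R i * C j = int n * (R i * C j)] (mod 4)"
      using n R[OF ij(1)] C[OF ij(2)] by (auto simp: cong_iff_dvd_diff elim!: oddE)
    finally have cong: "[k * b i j = int n * (R i * C j)] (mod 4)" .
    have "\<not> [- int n = int n] (mod 4)"
    proof
      assume "[- int n = int n] (mod 4)"
      then have "4 dvd 2 * int n" by (simp add: cong_iff_dvd_diff)
      then show False using n by presburger
    qed
    have bs: "b i j = 1 \<or> b i j = -1" using b[OF ij] by auto
    have "[k = int n * (b i j * (R i * C j))] (mod 4)"
      using cong_mult[OF cong_refl[of "b i j"] cong] bs by auto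
    with \<open>\<not> [- int n = int n] (mod 4)\<close> have "s = b i j * (R i * C j)"
      using bs R[OF ij(1)] C[OF ij(2)]
      using cong_trans[OF cong_sym, of k "- int n" 4 "int n"] by (auto simp: s_def)
    then show ?thesis
      using bs R[OF ij(1)] C[OF ij(2)] by (auto simp: w_def)
  qed
  have w: "w j = 1 \<or> w j = -1" if "j < n" for j
    using C[OF that] s by (auto simp: w_def)
  have n0: "0 < n" using n by (cases n) auto
  have "R 0 * w 0 * (\<Sum>l<n. R l * w l) = (\<Sum>l<n. b 0 l * b l 0)"
    using n0 by (simp add: fact sum_distrib_left mult_ac)
  also have "\<dots> = k * b 0 0" by (rule sq[OF n0 n0])
  also have "\<dots> = R 0 * w 0 * k" by (simp add: fact[OF n0 n0])
  finally have "R 0 * w 0 * (\<Sum>l<n. R l * w l) = R 0 * w 0 * k" .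
  then have "(\<Sum>l<n. R l * w l) = k"
    using R[OF n0] w[OF n0] by auto
  then show thesis
    using R w fact by (intro that[of R w]) auto
qed

lemma flat_idempotent_outer_product:
  assumes n: "odd n" and k: "k > 0" and A: "absolutely_flat_idempotent n k r A"
  obtains u w :: "nat \<Rightarrow> int"
  where "\<forall>i<n. u i \<in> {1, -1}" and "\<forall>i<n. w i \<in> {1, -1}"
    and "A = mat n n (\<lambda>(i, j). real_of_int (u i * w j) / real k)"
    and "(\<Sum>l<n. u l * w l) = int k"
proof -
  define b :: "nat \<Rightarrow> nat \<Rightarrow> int" where "b i j = (if A $$ (i, j) = 1 / real k then 1 else -1)" for i j
  have Ac: "A \<in> carrier_mat n n" and idem: "A * A = A"
    using A by (auto simp: absolutely_flat_idempotent_def)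
  have Ab: "A $$ (i, j) = real_of_int (b i j) / real k" if "i < n" "j < n" for i j
    using A that by (auto simp: absolutely_flat_idempotent_def b_def)
  have sq: "(\<Sum>l<n. b i l * b l j) = int k * b i j" if ij: "i < n" "j < n" for i j
  proof -
    have "real_of_int (b i j) / real k = (A * A) $$ (i, j)"
      using idem Ab[OF ij] by simp
    also have "\<dots> = (\<Sum>l<n. A $$ (i, l) * A $$ (l, j))"
      using Ac ij by (simp add: scalar_prod_def lessThan_atLeast0)
    also have "\<dots> = (\<Sum>l<n. real_of_int (b i l * b l j)) / (real k * real k)"
      using ij by (simp add: Ab sum_divide_distrib)
    finally have "real_of_int (\<Sum>l<n. b i l * b l j) = real_of_int (int k * b i j)"
      using k by (simp add: field_simps)
    then show ?thesis by linarith
  qed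
  have bs: "b i j \<in> {1, -1}" if "i < n" "j < n" for i j by (simp add: b_def)
  obtain u w :: "nat \<Rightarrow> int" where uw: "\<forall>i<n. u i \<in> {1, -1}" "\<forall>i<n. w i \<in> {1, -1}"
    "\<forall>i<n. \<forall>j<n. b i j = u i * w j" "(\<Sum>l<n. u l * w l) = int k"
    by (rule sign_matrix_square_factors[OF n bs sq])
  have "A = mat n n (\<lambda>(i, j). real_of_int (u i * w j) / real k)"
    using Ac by (intro eq_matI) (auto simp: Ab uw(3))
  from that[OF uw(1,2) this uw(4)] show thesis .
qed

section \<open>Rank one\<close>

lemma (in vec_space) rank_pos_if_nonzero_entry:
  assumes A: "A \<in> carrier_mat n nc" and ij: "i < n" "j < nc" and nz: "A $$ (i, j) \<noteq> 0"
  shows "rank A > 0"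
proof -
  have c: "col A j \<in> carrier_vec n" using A ij by auto
  have "col A j \<in> set (cols A)" using A ij by (auto simp: cols_def)
  moreover have "col A j \<noteq> 0\<^sub>v n"
    using A ij nz by (metis carrier_matD index_col index_zero_vec(1))
  then have "lin_indpt {col A j}"
    using lin_dep_iff_in_span[of "{}" "col A j"] c span_empty
    by (auto simp: lin_dep_def)
  ultimately show ?thesis
    using rank_ge_card_indpt[OF A, of "{col A j}"] by simp
qed

text \<open>
  Idempotency holds because the sign vector \<open>1, ..., 1, -1, ..., -1\<close> has sum \<open>n - 2m\<close>, and the
  choice of \<open>m\<close> makes this equal to \<open>k\<close>.
\<close>

lemma equal_rows_flat_mat_is_flat_idempotent:
  assumes k: "k > 0" and km: "n = k + 2 * m"
  shows "absolutely_flat_idempotent n k 1 (equal_rows_flat_mat n k m)"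
proof -
  let ?A = "equal_rows_flat_mat n k m"
  let ?f = "\<lambda>j. if j < n - m then 1 else -1 :: real"
  have A: "?A \<in> carrier_mat n n" by (simp add: equal_rows_flat_mat_def)
  have ent: "?A $$ (i, j) = 1 / real k * ?f j" if "i < n" "j < n" for i j
    using that by (simp add: equal_rows_flat_mat_def)
  have "sum ?f {..<n} = sum ?f {..<n - m} + sum ?f {n - m..<n}"
    by (subst sum.union_disjoint[symmetric]) (auto intro!: sum.cong)
  then have sum: "sum ?f {..<n} = real k"
    using km by simp
  have "(?A * ?A) $$ (i, j) = ?A $$ (i, j)" if ij: "i < n" "j < n" for i j
  proof -
    have "(?A * ?A) $$ (i, j) = (\<Sum>l<n. ?A $$ (i, l) * ?A $$ (l, j))"
      using A ij by (simp add: scalar_prod_def lessThan_atLeast0)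
    also have "\<dots> = (\<Sum>l<n. 1 / real k * (1 / real k * ?f j) * ?f l)"
      using ij by (intro sum.cong) (simp_all add: ent)
    also have "\<dots> = 1 / real k * (1 / real k * ?f j) * sum ?f {..<n}"
      by (simp only: sum_distrib_left)
    also have "\<dots> = 1 / real k * ?f j"
      unfolding sum using k by simp
    finally show ?thesis using ent[OF ij] by simp
  qed
  then have idem: "?A * ?A = ?A"
    using A by (intro eq_matI) auto
  have "vec_space.rank n ?A \<le> 1"
    using A ent by (intro vec_space.rank_le_1_product_entries[of _ _ n "\<lambda>_. 1 / real k" ?f]) auto
  moreover have "vec_space.rank n ?A > 0"
    using k km ent[of 0 0] by (intro vec_space.rank_pos_if_nonzero_entry[OF A, of 0 0]) auto
  ultimately show ?thesis
    using A idem ent by (simp add: absolutely_flat_idempotent_def)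
qed

section \<open>Reduction to equal rows\<close>

lemma signature_conjugation_step:
  fixes d :: "nat \<Rightarrow> real"
  assumes d: "\<forall>i<n. d i \<in> {1, -1}"
  shows "sp_similarity_step n (mat n n (\<lambda>(i, j). a i j)) (mat n n (\<lambda>(i, j). d i * a i j * d j))"
proof -
  let ?D = "mat n n (\<lambda>(i, j). if i = j then d i else 0)"
  have dd: "d i * d i = 1" if "i < n" for i using d that by auto
  have sig: "signature_mat n ?D"
    using d by (auto simp: signature_mat_def diagonal_mat_def)
  have left: "?D * mat n n (\<lambda>(i, j). x i j) = mat n n (\<lambda>(i, j). d i * x i j)" for x
    by (intro eq_matI) (auto simp: scalar_prod_def if_distrib if_distribR sum.delta' sum.delta cong: if_cong)
  have right: "mat n n (\<lambda>(i, j). x i j) * ?D = mat n n (\<lambda>(i, j). x i j * d j)" for x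
    by (intro eq_matI) (auto simp: scalar_prod_def if_distrib sum.delta' sum.delta cong: if_cong)
  have inv: "?D * ?D = 1\<^sub>m n"
    by (subst left) (intro eq_matI, auto simp: dd)
  have "similar_mat_wit (mat n n (\<lambda>(i, j). d i * a i j * d j)) (mat n n (\<lambda>(i, j). a i j)) ?D ?D"
    by (rule similar_mat_witI[OF inv inv]) (simp_all add: left right)
  with sig show ?thesis by (auto simp: sp_similarity_step_def)
qed

lemma permutation_conjugation_step:
  fixes a :: "nat \<Rightarrow> nat \<Rightarrow> real"
  assumes p: "p permutes {..<n}"
  shows "sp_similarity_step n (mat n n (\<lambda>(i, j). a i j)) (mat n n (\<lambda>(i, j). a (p i) (p j)))"
proof -
  let ?T = "mat n n (\<lambda>(i, j). if i = p j then 1 else 0) :: real mat"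
  let ?T' = "mat n n (\<lambda>(i, j). if j = p i then 1 else 0) :: real mat"
  have pn: "p i < n" if "i < n" for i using permutes_in_image[OF p, of i] that by simp
  have pinj: "p i = p j \<longleftrightarrow> i = j" for i j using permutes_inj[OF p] by (simp add: inj_eq)
  have left: "?T' * mat n n (\<lambda>(i, j). x i j) = mat n n (\<lambda>(i, j). x (p i) j)" for x
    by (intro eq_matI)
      (auto simp: scalar_prod_def if_distrib if_distribR pn sum.delta' sum.delta cong: if_cong)
  have right: "mat n n (\<lambda>(i, j). x i j) * ?T = mat n n (\<lambda>(i, j). x i (p j))" for x
    by (intro eq_matI)
      (auto simp: scalar_prod_def if_distrib if_distribR pn sum.delta' sum.delta cong: if_cong)
  have inv: "?T' * ?T = 1\<^sub>m n"
    by (subst left) (intro eq_matI, auto simp: pinj)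
  then have inv': "?T * ?T' = 1\<^sub>m n"
    by (intro mat_mult_left_right_inverse[of ?T' n ?T]) auto
  have "similar_mat_wit (mat n n (\<lambda>(i, j). a (p i) (p j))) (mat n n (\<lambda>(i, j). a i j)) ?T' ?T"
    by (rule similar_mat_witI[OF inv inv']) (simp_all add: left right)
  moreover have "permutation_mat n ?T"
    using p by (auto simp: permutation_mat_def)
  ultimately show ?thesis by (auto simp: sp_similarity_step_def)
qed

text \<open>
  Since the entries of \<open>u\<close> are signs, conjugation by their diagonal matrix cancels the row factor
  of \<open>u w\<^sup>T\<close> and moves it into the column factor; only the order of the columns is then left to
  adjust.
\<close>

lemma outer_product_sp_similar_equal_rows:
  fixes u w :: "nat \<Rightarrow> int"
  assumes u: "\<forall>i<n. u i \<in> {1, -1}" and w: "\<forall>i<n. w i \<in> {1, -1}"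
    and uw: "(\<Sum>l<n. u l * w l) = int k" and km: "n = k + 2 * m"
  shows "sp_similar n (mat n n (\<lambda>(i, j). real_of_int (u i * w j) / real k))
           (equal_rows_flat_mat n k m)"
proof -
  define v where "v j = u j * w j" for j
  define f :: "nat \<Rightarrow> int" where "f j = (if j < n - m then 1 else -1)" for j
  have v: "\<forall>j\<in>{..<n}. v j \<in> {1, -1}"
    using sign_mult u w by (simp add: v_def)
  have f: "\<forall>j\<in>{..<n}. f j \<in> {1, -1}"
    by (simp add: f_def)
  have "sum f {..<n} = sum f {..<n - m} + sum f {n - m..<n}"
    by (subst sum.union_disjoint[symmetric]) (auto intro!: sum.cong)
  then have sum_eq: "sum f {..<n} = sum v {..<n}"
    using km uw by (simp add: f_def v_def)
  obtain p where p: "p permutes {..<n}" and fv: "\<forall>x\<in>{..<n}. f x = v (p x)"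
    by (rule signs_permuted_of_sum_eq[OF finite_lessThan f v sum_eq])
  have uu: "u i * u i = 1" if "i < n" for i using u that by auto
  let ?V = "mat n n (\<lambda>(i, j). real_of_int (v j) / real k)"
  have "sp_similarity_step n (mat n n (\<lambda>(i, j). real_of_int (u i * w j) / real k))
      (mat n n (\<lambda>(i, j). real_of_int (u i) * (real_of_int (u i * w j) / real k) * real_of_int (u j)))"
    using u by (intro signature_conjugation_step) auto
  also have "mat n n (\<lambda>(i, j). real_of_int (u i) * (real_of_int (u i * w j) / real k) * real_of_int (u j)) = ?V"
  proof (intro eq_matI)
    fix i j assume "i < dim_row ?V" "j < dim_col ?V"
    then have ij: "i < n" "j < n" by auto
    have "real_of_int (u i) * real_of_int (u i) = 1"
      using uu[OF ij(1)] by (metis of_int_1 of_int_mult)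
    then have "real_of_int (u i) * (real_of_int (u i * w j) / real k) * real_of_int (u j)
        = real_of_int (v j) / real k"
      by (simp add: v_def mult_ac)
    then show "mat n n (\<lambda>(i, j). real_of_int (u i) * (real_of_int (u i * w j) / real k) * real_of_int (u j)) $$ (i, j)
        = ?V $$ (i, j)"
      using ij by simp
  qed auto
  finally have step1: "sp_similarity_step n (mat n n (\<lambda>(i, j). real_of_int (u i * w j) / real k)) ?V" .
  have "mat n n (\<lambda>(i, j). real_of_int (v (p j)) / real k) = equal_rows_flat_mat n k m"
    using fv by (intro eq_matI) (auto simp: equal_rows_flat_mat_def f_def split: if_splits)
  then have step2: "sp_similarity_step n ?V (equal_rows_flat_mat n k m)"
    using permutation_conjugation_step[OF p, of "\<lambda>i j. real_of_int (v j) / real k"] by simp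
  from step1 step2 show ?thesis
    unfolding sp_similar_def by (rule converse_rtranclp_into_rtranclp[OF _ r_into_rtranclp])
qed

section \<open>Classification for odd order\<close>

lemma flat_idempotent_odd_parameters:
  assumes n: "odd n" and k: "k > 0" and r: "r > 0" and A: "absolutely_flat_idempotent n k r A"
  shows "r = 1 \<and> k \<le> n \<and> odd k"
proof -
  obtain u w :: "nat \<Rightarrow> int" where u: "\<forall>i<n. u i \<in> {1, -1}" and w: "\<forall>i<n. w i \<in> {1, -1}"
    and Aeq: "A = mat n n (\<lambda>(i, j). real_of_int (u i * w j) / real k)"
    and uw: "(\<Sum>l<n. u l * w l) = int k"
    by (rule flat_idempotent_outer_product[OF n k A])
  have "vec_space.rank n A \<le> 1"
    by (rule vec_space.rank_le_1_product_entries[of _ _ n "\<lambda>i. real_of_int (u i)" "\<lambda>j. real_of_int (w j) / real k"])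
      (auto simp: Aeq)
  then have "r = 1"
    using A r by (simp add: absolutely_flat_idempotent_def)
  define c where "c = card {l \<in> {..<n}. u l * w l = 1}"
  have "c \<le> n"
    using card_mono[of "{..<n}" "{l \<in> {..<n}. u l * w l = 1}"] by (auto simp: c_def)
  have "\<forall>l\<in>{..<n}. u l * w l \<in> {1, -1}" using sign_mult u w by simp
  from sum_signs_eq_card[OF _ this] have "int k = 2 * int c - int n"
    using uw by (simp add: c_def)
  then have "k + n = 2 * c" by linarith
  then have "odd k" and "k \<le> n" using n \<open>c \<le> n\<close> by presburger+
  with \<open>r = 1\<close> show ?thesis by simp
qed

theorem theorem3p1:
  fixes n k r :: nat
  assumes "odd n" and "k > 0" and "r > 0"
  shows "((\<exists>A. absolutely_flat_idempotent n k r A) \<longleftrightarrow> r = 1 \<and> k \<le> n \<and> odd k) \<and>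
         (r = 1 \<and> k \<le> n \<and> odd k \<longrightarrow>
            (let A\<^sub>0 = equal_rows_flat_mat n k ((n - r * k) div 2)
             in absolutely_flat_idempotent n k r A\<^sub>0 \<and>
                (\<forall>A. absolutely_flat_idempotent n k r A \<longrightarrow> sp_similar n A A\<^sub>0)))"
proof -
  let ?A\<^sub>0 = "equal_rows_flat_mat n k ((n - r * k) div 2)"
  have normal_form: "absolutely_flat_idempotent n k r ?A\<^sub>0 \<and>
      (\<forall>A. absolutely_flat_idempotent n k r A \<longrightarrow> sp_similar n A ?A\<^sub>0)"
    if par: "r = 1 \<and> k \<le> n \<and> odd k"
  proof -
    have km: "n = k + 2 * ((n - r * k) div 2)"
      using par \<open>odd n\<close> by simp
    have "absolutely_flat_idempotent n k r ?A\<^sub>0"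
      using equal_rows_flat_mat_is_flat_idempotent[OF \<open>k > 0\<close> km] par by simp
    moreover have "sp_similar n A ?A\<^sub>0" if A_flat: "absolutely_flat_idempotent n k r A" for A
    proof -
      obtain u w :: "nat \<Rightarrow> int" where u: "\<forall>i<n. u i \<in> {1, -1}" and w: "\<forall>i<n. w i \<in> {1, -1}"
        and A: "A = mat n n (\<lambda>(i, j). real_of_int (u i * w j) / real k)"
        and uw: "(\<Sum>l<n. u l * w l) = int k"
        by (rule flat_idempotent_outer_product[OF \<open>odd n\<close> \<open>k > 0\<close> A_flat])
      show ?thesis
        unfolding A by (rule outer_product_sp_similar_equal_rows[OF u w uw km])
    qed
    ultimately show ?thesis by blast
  qed
  moreover have "r = 1 \<and> k \<le> n \<and> odd k" if "\<exists>A. absolutely_flat_idempotent n k r A"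
    using that flat_idempotent_odd_parameters[OF assms] by blast
  ultimately show ?thesis
    unfolding Let_def by blast
qed

end
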